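(* Fix $\alpha,\beta>0$, let $\kappa:=\beta/\alpha$ and $N:=\lfloor(\kappa-2)/32\rfloor$, and suppose that $\kappa\ge 258$. For every randomized method using at most $\lfloor N/(128\log(2N))\rfloor$ calls to a $1$-fold sparse projection oracle, there exists an instance in dimension $n=2N$ with an $\alpha$-strongly convex and $\beta$-smooth quadratic objective $f:\mathbb R^{2N}\to\mathbb R$, a compact convex feasible set $\mathcal K\subset\mathbb R^{2N}$ of diameter $D\le 2$, and a unique minimizer $w^*$ of $f$ over $\mathcal K$, which is a vertex of $\mathcal K$, such that, writing $F=f+I_{\mathcal K}$, the output $\widehat w$ of the method satisfies $$ \mathbb E\left[F(\widehat w)-F(w^* )\right]\ \ge\ \frac{\alpha}{8}, $$ where the expectation is over the method's internal randomness. Consequently, for $\epsilon=\alpha/16$, every randomized method that guarantees expected error at most $\epsilon$ on all such instances requires $\Omega\left((\beta/\alpha)/\log(2\beta/\alpha)\right)$ calls to the $1$-fold sparse projection oracle in the worst case (with a universal constant in the $\Omega$).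
   Context: Problem: minimize $F=f+I_{\mathcal K}$, where $f$ is convex, $\mathcal K\subset\mathbb R^n$ is convex and compact with set of vertices (extreme points) $\mathcal V$, and $I_{\mathcal K}$ is $0$ on $\mathcal K$ and $+\infty$ outside; thus infeasible outputs have infinite error $F(\widehat w)-F(w^* )$. Norms are Euclidean, $\log$ is the natural logarithm, and $\beta$-smooth means differentiable with $\beta$-Lipschitz gradient. $1$-fold sparse projection oracle (when the optimal solution is a single vertex): given $y\in\mathbb R^n$, it outputs a point of $\arg\min_{z\in\mathcal V}\|z-y\|$, with ties broken by a deterministic rule that is part of the instance. Access model: the method is not given an explicit description of $\mathcal K$; its only access to $\mathcal K$ is through the $1$-fold sparse projection oracle. It may otherwise perform arbitrary computations and make arbitrarily many calls to a first-order oracle for $f$ (returning $f(w)$ and $\nabla f(w)$ at a query $w$). Only sparse-projection calls are counted. A randomized method may use internal random bits (independent of the instance) to choose its queries and its output $\widehat w\in\mathbb R^n$; the bound on the number of sparse-projection calls must hold for every realization of its internal randomness. The instance in the statement may depend on the method but not on its random bits. Expected error means $\mathbb E[F(\widehat w)-F(w^* )]$. *)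

theory Defs
  imports "HOL-Probability.Probability"
begin

definition strongly_convex :: "real \<Rightarrow> ('v::real_inner \<Rightarrow> real) \<Rightarrow> bool" where
  "strongly_convex \<alpha> f \<longleftrightarrow>
     (\<forall>x y. \<forall>t\<in>{0..1}.
        f ((1 - t) *\<^sub>R x + t *\<^sub>R y)
          \<le> (1 - t) * f x + t * f y - \<alpha> / 2 * t * (1 - t) * (norm (x - y))\<^sup>2)"

definition gradient :: "('v::real_inner \<Rightarrow> real) \<Rightarrow> 'v \<Rightarrow> 'v" where
  "gradient f w = (THE g. GDERIV f w :> g)"

definition smooth :: "real \<Rightarrow> ('v::real_inner \<Rightarrow> real) \<Rightarrow> bool" where
  "smooth \<beta> f \<longleftrightarrow> (\<forall>w. f differentiable at w) \<and> \<beta>-lipschitz_on UNIV (gradient f)"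

definition quadratic :: "(real^'n \<Rightarrow> real) \<Rightarrow> bool" where
  "quadratic f \<longleftrightarrow> (\<exists>A b c. \<forall>w. f w = w \<bullet> (A *v w) + b \<bullet> w + c)"

definition vertices :: "'v::real_vector set \<Rightarrow> 'v set" where
  "vertices K = {v. v extreme_point_of K}"

text \<open>
  An instance consists of the smooth part of the objective, the feasible set, and the answer
  function of the 1-fold sparse projection oracle. The latter is a fixed function, so it carries
  the deterministic tie-breaking rule.
\<close>

record 'v problem =
  objective :: "'v \<Rightarrow> real"
  feasible :: "'v set"
  proj :: "'v \<Rightarrow> 'v"

definition sparse_projection :: "'v::real_normed_vector set \<Rightarrow> ('v \<Rightarrow> 'v) \<Rightarrow> bool" where
  "sparse_projection K P \<longleftrightarrow>
     (\<forall>y. is_arg_min (\<lambda>z. norm (z - y)) (\<lambda>z. z \<in> vertices K) (P y))"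

definition admissible :: "real \<Rightarrow> real \<Rightarrow> (real^'n) problem \<Rightarrow> real^'n \<Rightarrow> bool" where
  "admissible \<alpha> \<beta> I wopt \<longleftrightarrow>
     quadratic (objective I) \<and> strongly_convex \<alpha> (objective I) \<and> smooth \<beta> (objective I) \<and>
     compact (feasible I) \<and> convex (feasible I) \<and> diameter (feasible I) \<le> 2 \<and>
     sparse_projection (feasible I) (proj I) \<and>
     {w. is_arg_min (objective I) (\<lambda>z. z \<in> feasible I) w} = {wopt} \<and>
     wopt \<in> vertices (feasible I)"

definition composite_objective :: "'v problem \<Rightarrow> 'v \<Rightarrow> ereal" where
  "composite_objective I w = ereal (objective I w) + (if w \<in> feasible I then 0 else \<infinity>)"

text \<open>
  The deterministic behaviour that remains once the random bits are fixed: an adaptive query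
  strategy, which either returns a point or puts a query to one of the two oracles and continues
  depending on the answer. The continuations are arbitrary functions, so computation between
  queries is unrestricted; being an inductive datatype, every run is finite, with no a priori bound
  on its length.
\<close>

datatype 'v strategy =
    Return 'v
  | First_Order 'v "real \<times> 'v \<Rightarrow> 'v strategy"
  | Project 'v "'v \<Rightarrow> 'v strategy"

primrec run_output :: "'v::real_inner problem \<Rightarrow> 'v strategy \<Rightarrow> 'v" where
  "run_output I (Return w) = w"
| "run_output I (First_Order w k) = run_output I (k (objective I w, gradient (objective I) w))"
| "run_output I (Project y k) = run_output I (k (proj I y))"

primrec projection_calls :: "'v::real_inner problem \<Rightarrow> 'v strategy \<Rightarrow> nat" where
  "projection_calls I (Return w) = 0"
| "projection_calls I (First_Order w k) =
     projection_calls I (k (objective I w, gradient (objective I) w))"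
| "projection_calls I (Project y k) = Suc (projection_calls I (k (proj I y)))"

text \<open>
  A randomized algorithm draws a seed from a probability space that is independent of the instance,
  and then follows the strategy selected by the seed. Measurability of the output is what makes
  its expected error meaningful.
\<close>

definition randomized_algorithm ::
    "real \<Rightarrow> real \<Rightarrow> 'r measure \<Rightarrow> ('r \<Rightarrow> (real^'n) strategy) \<Rightarrow> bool" where
  "randomized_algorithm \<alpha> \<beta> R S \<longleftrightarrow>
     prob_space R \<and>
     (\<forall>I wopt. admissible \<alpha> \<beta> I wopt \<longrightarrow> (\<lambda>r. run_output I (S r)) \<in> borel_measurable R)"

definition projection_budget ::
    "real \<Rightarrow> real \<Rightarrow> 'r measure \<Rightarrow> ('r \<Rightarrow> (real^'n) strategy) \<Rightarrow> nat \<Rightarrow> bool" where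
  "projection_budget \<alpha> \<beta> R S T \<longleftrightarrow>
     (\<forall>I wopt. admissible \<alpha> \<beta> I wopt \<longrightarrow> (\<forall>r\<in>space R. projection_calls I (S r) \<le> T))"

text \<open>
  The error is nonnegative (possibly infinite) whenever \<open>wopt\<close> is a minimizer, so the truncation
  of negative values by \<^const>\<open>e2ennreal\<close> is not felt.
\<close>

definition expected_error ::
    "'r measure \<Rightarrow> ('r \<Rightarrow> 'v::real_inner strategy) \<Rightarrow> 'v problem \<Rightarrow> 'v \<Rightarrow> ennreal" where
  "expected_error R S I wopt =
     (\<integral>\<^sup>+ r. e2ennreal (composite_objective I (run_output I (S r)) - composite_objective I wopt) \<partial>R)"

end

(*
  The objective is one fixed quadratic, of curvature alpha on N coordinates (the set A) and beta on
  the remaining N, so only the feasible set has to be discovered. It is the convex hull of a sphere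
  of decoys attached to each signed axis tau_i e_i outside A, together with one hidden vertex: e_j
  for some j in A plus a small multiple of the sign vector tau. As beta is at least 32 N alpha, the
  curvature outside A makes the hidden vertex beat the hull of the decoys by a constant times alpha.
  The oracle returns the hidden vertex only to a query y that has the wrong sign in every coordinate
  outside A (one tau per query), or whose part in A is dominated by y_j (at most one j per query).
  While only decoys are returned there are at most (2N)^T transcripts, so after T calls at least half
  of the 2^N N pairs (tau, j) are unsolved for each seed, and averaging yields a bad instance.
*)
theory Submission
  imports Defs
begin

section \<open>Diagonal quadratics and convex hulls\<close>

definition diagonal_quadratic :: "('n \<Rightarrow> real) \<Rightarrow> real^'n::finite \<Rightarrow> real" where
  "diagonal_quadratic h w = (\<Sum>i\<in>UNIV. h i * (w $ i)\<^sup>2) / 2"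

lemma quadratic_diagonal_quadratic:
  fixes h :: "'n::finite \<Rightarrow> real"
  shows "quadratic (diagonal_quadratic h)"
  unfolding quadratic_def
proof (intro exI allI)
  fix w :: "real^'n"
  have "(\<Sum>j\<in>UNIV. (if i = j then h i / 2 else 0) * w $ j) = h i / 2 * w $ i" for i
    by (subst sum.cong[OF refl, where h = "\<lambda>j. if i = j then h i / 2 * w $ j else 0"]) auto
  then have "(\<chi> i j. if i = j then h i / 2 else 0) *v w = (\<chi> i. h i / 2 * w $ i)"
    by (simp only: matrix_vector_mult_def vec_lambda_beta)
  then have "w \<bullet> ((\<chi> i j. if i = j then h i / 2 else 0) *v w) = diagonal_quadratic h w"
    by (simp add: inner_vec_def diagonal_quadratic_def sum_divide_distrib power2_eq_square mult_ac)
  then show "diagonal_quadratic h w =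
      w \<bullet> ((\<chi> i j. if i = j then h i / 2 else 0) *v w) + 0 \<bullet> w + 0"
    by simp
qed

lemma GDERIV_diagonal_quadratic: "GDERIV (diagonal_quadratic h) w :> (\<chi> i. h i * w $ i)"
proof -
  have nth: "((\<lambda>w. w $ i) has_derivative (\<lambda>v. v $ i)) (at w)" for i
    by (rule bounded_linear_imp_has_derivative) (rule bounded_linear_vec_nth)
  have "((\<lambda>w. (\<Sum>i\<in>UNIV. h i * (w $ i)\<^sup>2) / 2) has_derivative
      (\<lambda>v. (\<Sum>i\<in>UNIV. h i * (2 * w $ i * v $ i)) / 2)) (at w)"
    by (auto intro!: derivative_eq_intros nth simp: mult_ac)
  moreover have "(\<Sum>i\<in>UNIV. h i * (2 * w $ i * v $ i)) / 2 = v \<bullet> (\<chi> i. h i * w $ i)" for v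
    by (simp add: inner_vec_def sum_divide_distrib algebra_simps)
  ultimately show ?thesis
    by (simp add: gderiv_def diagonal_quadratic_def[abs_def])
qed

lemma gradient_diagonal_quadratic: "gradient (diagonal_quadratic h) w = (\<chi> i. h i * w $ i)"
  unfolding gradient_def
proof (rule the_equality)
  show "GDERIV (diagonal_quadratic h) w :> (\<chi> i. h i * w $ i)"
    by (rule GDERIV_diagonal_quadratic)
  fix g assume "GDERIV (diagonal_quadratic h) w :> g"
  then have "(\<lambda>v. v \<bullet> g) = (\<lambda>v. v \<bullet> (\<chi> i. h i * w $ i))"
    using GDERIV_diagonal_quadratic[of h w] unfolding gderiv_def by (rule has_derivative_unique)
  from fun_cong[OF this, of "g - (\<chi> i. h i * w $ i)"]
  have "(g - (\<chi> i. h i * w $ i)) \<bullet> (g - (\<chi> i. h i * w $ i)) = 0"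
    by (simp add: inner_diff_right)
  then show "g = (\<chi> i. h i * w $ i)"
    by simp
qed

text \<open>Up to the factor 1/2, the convexity defect in coordinate \<open>i\<close> is exactly
  \<open>t * (1 - t) * h i * (x $ i - y $ i)^2\<close>, so a lower bound on every curvature
  suffices.\<close>

lemma strongly_convex_diagonal_quadratic:
  fixes h :: "'n::finite \<Rightarrow> real"
  assumes "\<And>i. \<alpha> \<le> h i"
  shows "strongly_convex \<alpha> (diagonal_quadratic h)"
  unfolding strongly_convex_def
proof (intro allI ballI)
  fix x y :: "real^'n" and t :: real
  assume "t \<in> {0..1}"
  then have t: "0 \<le> t * (1 - t)"
    by simp
  have 1: "(1 - t) * (h i * (x $ i)\<^sup>2) + t * (h i * (y $ i)\<^sup>2) - h i * ((1 - t) * x $ i + t * y $ i)\<^sup>2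
      = t * (1 - t) * h i * (x $ i - y $ i)\<^sup>2" for i
    by algebra
  have norm: "(norm (x - y))\<^sup>2 = (\<Sum>i\<in>UNIV. (x $ i - y $ i)\<^sup>2)"
    unfolding power2_norm_eq_inner by (simp add: inner_vec_def power2_eq_square)
  have 2: "t * (1 - t) * \<alpha> * (x $ i - y $ i)\<^sup>2 \<le> t * (1 - t) * h i * (x $ i - y $ i)\<^sup>2" for i
    using assms t by (intro mult_right_mono mult_left_mono) auto
  then have "h i * ((1 - t) * x $ i + t * y $ i)\<^sup>2
      \<le> (1 - t) * (h i * (x $ i)\<^sup>2) + t * (h i * (y $ i)\<^sup>2) - t * (1 - t) * \<alpha> * (x $ i - y $ i)\<^sup>2" for i
    using 1[of i] 2[of i] by linarith
  then have "(\<Sum>i\<in>UNIV. h i * ((1 - t) * x $ i + t * y $ i)\<^sup>2)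
     \<le> (\<Sum>i\<in>UNIV. (1 - t) * (h i * (x $ i)\<^sup>2) + t * (h i * (y $ i)\<^sup>2)
          - t * (1 - t) * \<alpha> * (x $ i - y $ i)\<^sup>2)"
    by (intro sum_mono)
  also have "\<dots> = (1 - t) * (\<Sum>i\<in>UNIV. h i * (x $ i)\<^sup>2) + t * (\<Sum>i\<in>UNIV. h i * (y $ i)\<^sup>2)
       - t * (1 - t) * \<alpha> * (norm (x - y))\<^sup>2"
    unfolding norm by (simp only: sum.distrib sum_subtractf sum_distrib_left)
  finally have "(\<Sum>i\<in>UNIV. h i * ((1 - t) * x $ i + t * y $ i)\<^sup>2) / 2
      \<le> ((1 - t) * (\<Sum>i\<in>UNIV. h i * (x $ i)\<^sup>2) + t * (\<Sum>i\<in>UNIV. h i * (y $ i)\<^sup>2)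
       - t * (1 - t) * \<alpha> * (norm (x - y))\<^sup>2) / 2"
    by (rule divide_right_mono) simp
  then show "diagonal_quadratic h ((1 - t) *\<^sub>R x + t *\<^sub>R y)
      \<le> (1 - t) * diagonal_quadratic h x + t * diagonal_quadratic h y
         - \<alpha> / 2 * t * (1 - t) * (norm (x - y))\<^sup>2"
    by (simp add: diagonal_quadratic_def add_divide_distrib diff_divide_distrib mult_ac)
qed

lemma smooth_diagonal_quadratic:
  fixes h :: "'n::finite \<Rightarrow> real"
  assumes "\<And>i. \<bar>h i\<bar> \<le> \<beta>" and "0 \<le> \<beta>"
  shows "smooth \<beta> (diagonal_quadratic h)"
  unfolding smooth_def
proof
  show "\<forall>w. diagonal_quadratic h differentiable at w"
    using GDERIV_diagonal_quadratic[unfolded gderiv_def] by (blast intro: differentiableI)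
  show "\<beta>-lipschitz_on UNIV (gradient (diagonal_quadratic h))"
  proof (rule lipschitz_onI)
    fix x y :: "real^'n"
    have "norm (h i * x $ i - h i * y $ i) \<le> norm (\<beta> * (x $ i - y $ i))" for i
      unfolding right_diff_distrib[symmetric] real_norm_def abs_mult
      using assms by (intro mult_right_mono) auto
    then have "norm ((\<chi> i. h i * x $ i) - (\<chi> i. h i * y $ i)) \<le> norm (\<beta> *\<^sub>R (x - y))"
      by (intro norm_le_componentwise_cart) simp
    then show "dist (gradient (diagonal_quadratic h) x) (gradient (diagonal_quadratic h) y)
        \<le> \<beta> * dist x y"
      using \<open>0 \<le> \<beta>\<close> by (simp add: gradient_diagonal_quadratic dist_norm)
  qed fact
qed

text \<open>The remainder of the exact expansion at \<open>v\<close> is half the sum of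
  \<open>h i * (w $ i - v $ i)^2\<close>. This later turns a linear gap at the hidden vertex into a
  gap of the objective.\<close>

lemma diagonal_quadratic_ge_tangent:
  assumes "\<And>i. 0 \<le> h i"
  shows "diagonal_quadratic h v + (\<chi> i. h i * v $ i) \<bullet> (w - v) \<le> diagonal_quadratic h w"
proof -
  have 1: "h i * (w $ i)\<^sup>2 = h i * (v $ i)\<^sup>2 + 2 * (h i * v $ i * (w $ i - v $ i)) + h i * (w $ i - v $ i)\<^sup>2" for i
    by algebra
  have "h i * (v $ i)\<^sup>2 + 2 * (h i * v $ i * (w $ i - v $ i)) \<le> h i * (w $ i)\<^sup>2" for i
    using 1[of i] assms[of i] by simp
  then have "(\<Sum>i\<in>UNIV. h i * (v $ i)\<^sup>2 + 2 * (h i * v $ i * (w $ i - v $ i)))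
      \<le> (\<Sum>i\<in>UNIV. h i * (w $ i)\<^sup>2)"
    by (intro sum_mono)
  then show ?thesis
    by (simp add: diagonal_quadratic_def inner_vec_def sum.distrib sum_distrib_left[symmetric])
qed

text \<open>A proper subset of \<open>V\<close> misses some \<open>v\<close>, hence lies in an open
  half-space with \<open>v\<close> on its boundary. Its hull lies there too, so no proper subset
  generates the hull of \<open>V\<close>.\<close>

lemma extreme_points_of_convex_hull_strictly_supported:
  fixes V :: "'v::euclidean_space set"
  assumes "compact V" and supp: "\<And>v. v \<in> V \<Longrightarrow> \<exists>y. \<forall>x\<in>V - {v}. y \<bullet> x < y \<bullet> v"
  shows "{x. x extreme_point_of (convex hull V)} = V"
proof (rule extreme_points_of_convex_hull_eq[OF \<open>compact V\<close>])
  fix T assume "T \<subset> V"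
  then obtain v where v: "v \<in> V" "v \<notin> T" by blast
  then obtain y where y: "\<forall>x\<in>V - {v}. y \<bullet> x < y \<bullet> v"
    using supp by blast
  with v \<open>T \<subset> V\<close> have "T \<subseteq> {x. y \<bullet> x < y \<bullet> v}"
    by auto
  then have "convex hull T \<subseteq> {x. y \<bullet> x < y \<bullet> v}"
    by (rule hull_minimal) (rule convex_halfspace_lt)
  moreover have "v \<in> convex hull V"
    using v(1) by (rule hull_inc)
  ultimately show "convex hull T \<noteq> convex hull V"
    by auto
qed

lemma diameter_convex_hull_le:
  fixes V :: "'v::euclidean_space set"
  assumes "0 \<le> d" and "\<And>x y. x \<in> V \<Longrightarrow> y \<in> V \<Longrightarrow> dist x y \<le> d"
  shows "diameter (convex hull V) \<le> d"
proof (rule diameter_le)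
  have 1: "convex hull V \<subseteq> cball x d" if "x \<in> V" for x
    using that assms by (intro hull_minimal) auto
  fix x y assume x: "x \<in> convex hull V" and y: "y \<in> convex hull V"
  \<comment> \<open>The ball argument is used twice: around points of \<open>V\<close> it places the
    hull point \<open>x\<close> within \<open>d\<close> of all of \<open>V\<close>, and then it
    applies around \<open>x\<close> itself.\<close>
  have "V \<subseteq> cball x d"
    using 1 x by (metis dist_commute mem_cball subset_eq)
  then have "convex hull V \<subseteq> cball x d"
    by (rule hull_minimal) simp
  with y show "norm (x - y) \<le> d"
    by (auto simp: dist_norm)
qed (use assms in simp)

lemma convex_hull_insert_cases:
  assumes "x \<in> convex hull (insert a S)" and "S \<noteq> {}"
  obtains \<mu> b where "0 \<le> \<mu>" "\<mu> \<le> 1" "b \<in> convex hull S" "x = (1 - \<mu>) *\<^sub>R a + \<mu> *\<^sub>R b"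
proof -
  from assms obtain u v b where "0 \<le> u" "0 \<le> v" "u + v = 1" "b \<in> convex hull S" "x = u *\<^sub>R a + v *\<^sub>R b"
    by (auto simp: convex_hull_insert)
  moreover from \<open>u + v = 1\<close> have "u = 1 - v" by simp
  ultimately show thesis
    by (intro that[of v b]) auto
qed

section \<open>The hard instances\<close>

text \<open>Expanding the squares, \<open>y \<bullet> y\<close> cancels. In particular, among points
  of equal norm the nearest to \<open>y\<close> is the one with the largest inner product.\<close>

lemma norm_diff_less_iff:
  fixes a b y :: "'v::real_inner"
  shows "norm (a - y) < norm (b - y) \<longleftrightarrow> a \<bullet> a - 2 * (a \<bullet> y) < b \<bullet> b - 2 * (b \<bullet> y)"
  by (simp add: norm_lt inner_diff_left inner_diff_right inner_commute)

locale hidden_vertex =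
  fixes A :: "'n::finite set" and N :: nat and \<alpha> \<beta> :: real
  assumes card_A: "card A = N" and card_compl: "card (- A) = N"
    and N_ge: "8 \<le> N" and \<alpha>_pos: "0 < \<alpha>" and \<beta>_ge: "32 * real N * \<alpha> \<le> \<beta>"
begin

text \<open>The pattern is given by the set of coordinates with sign 1, so that patterns can be
  counted through \<open>Pow (- A)\<close>.\<close>

definition signs :: "'n set \<Rightarrow> real^'n" where
  "signs \<tau> = (\<chi> i. if i \<in> A then 0 else if i \<in> \<tau> then 1 else - 1)"

definition obj :: "real^'n \<Rightarrow> real" where
  "obj = diagonal_quadratic (\<lambda>i. if i \<in> A then \<alpha> else \<beta>)"

text \<open>The weight makes the inner product with \<open>signs \<tau>\<close> equal to 3/10, half
  of the 3/5 that every decoy has, while the pull of a query along the signs is averaged over all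
  \<open>N\<close> coordinates.\<close>

definition hidden :: "'n set \<Rightarrow> 'n \<Rightarrow> real^'n" where
  "hidden \<tau> j = axis j 1 + (3 / (10 * real N)) *\<^sub>R signs \<tau>"

text \<open>The radius 3/4 serves two ends. As 2 * (9/16) > 1, two coordinates of a vector cannot
  both exceed 3/4 of its norm. As 9/16 + 9/25 = 369/400 < 1, every decoy is shorter than the hidden
  vertex.\<close>

definition sphere_A :: "(real^'n) set" where
  "sphere_A = {u. norm u = 3 / 4 \<and> (\<forall>i. i \<notin> A \<longrightarrow> u $ i = 0)}"

definition decoy :: "'n set \<Rightarrow> real^'n \<Rightarrow> 'n \<Rightarrow> real^'n" where
  "decoy \<tau> u i = u + axis i (3 / 5 * signs \<tau> $ i)"

definition decoys :: "'n set \<Rightarrow> (real^'n) set" where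
  "decoys \<tau> = {decoy \<tau> u i |u i. u \<in> sphere_A \<and> i \<notin> A}"

definition part_A :: "real^'n \<Rightarrow> real^'n" where
  "part_A y = (\<chi> i. if i \<in> A then y $ i else 0)"

definition direction :: "real^'n \<Rightarrow> real^'n" where
  "direction y = (if part_A y = 0 then axis (SOME j. j \<in> A) (3 / 4)
     else (3 / 4 / norm (part_A y)) *\<^sub>R part_A y)"

definition best_sign :: "'n set \<Rightarrow> real^'n \<Rightarrow> 'n" where
  "best_sign \<tau> y = (SOME i. i \<notin> A \<and> (\<forall>l. l \<notin> A \<longrightarrow> signs \<tau> $ l * y $ l \<le> signs \<tau> $ i * y $ i))"

definition decoy_oracle :: "'n set \<Rightarrow> real^'n \<Rightarrow> real^'n" where
  "decoy_oracle \<tau> y = decoy \<tau> (direction y) (best_sign \<tau> y)"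

text \<open>Ties go to the decoy, and the choice among decoys does not depend on \<open>j\<close>.
  So an answer can depend on \<open>j\<close> only when the hidden vertex is strictly
  closer.\<close>

definition hard_instance :: "'n set \<Rightarrow> 'n \<Rightarrow> (real^'n) problem" where
  "hard_instance \<tau> j =
     \<lparr>objective = obj,
      feasible = convex hull (insert (hidden \<tau> j) (decoys \<tau>)),
      proj = (\<lambda>y. if norm (hidden \<tau> j - y) < norm (decoy_oracle \<tau> y - y)
                  then hidden \<tau> j else decoy_oracle \<tau> y)\<rparr>"

section \<open>Norms and inner products of the vertices\<close>

lemma N_pos: "0 < real N"
  using N_ge by simp

lemma A_nonempty: "A \<noteq> {}" and compl_A_nonempty: "- A \<noteq> {}"
  using card_A card_compl N_ge by auto

lemma \<alpha>_le_\<beta>: "\<alpha> \<le> \<beta>"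
proof -
  have "1 * \<alpha> \<le> 32 * real N * \<alpha>"
    using N_ge \<alpha>_pos by (intro mult_right_mono) auto
  then show ?thesis using \<beta>_ge by simp
qed

lemma signs_nth: "j \<in> A \<Longrightarrow> signs \<tau> $ j = 0"
  by (simp add: signs_def)

lemma signs_square: "i \<notin> A \<Longrightarrow> signs \<tau> $ i * signs \<tau> $ i = 1"
  by (simp add: signs_def)

lemma inner_signs: "signs \<tau> \<bullet> y = (\<Sum>i\<in>-A. signs \<tau> $ i * y $ i)"
proof -
  have "(\<Sum>i\<in>UNIV. signs \<tau> $ i * y $ i) = (\<Sum>i\<in>-A. signs \<tau> $ i * y $ i)"
    by (rule sum.mono_neutral_right) (auto simp: signs_def)
  then show ?thesis by (simp add: inner_vec_def)
qed

lemma inner_signs_signs: "signs \<tau> \<bullet> signs \<tau> = real N"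
  by (simp add: inner_signs signs_square card_compl)

lemma inner_hidden: "hidden \<tau> j \<bullet> y = y $ j + 3 / (10 * real N) * (signs \<tau> \<bullet> y)"
  by (simp add: hidden_def inner_add_left inner_axis')

lemma hidden_nth: "i \<in> A \<Longrightarrow> hidden \<tau> j $ i = (if i = j then 1 else 0)"
  by (simp add: hidden_def signs_def axis_def)

lemma inner_hidden_hidden: "j \<in> A \<Longrightarrow> hidden \<tau> j \<bullet> hidden \<tau> j = 1 + 9 / (100 * real N)"
  unfolding inner_hidden using N_pos
  by (simp add: hidden_nth)
    (simp add: hidden_def inner_add_right inner_signs_signs inner_axis signs_nth field_simps)

lemma inner_hidden_hidden_bounds:
  assumes "j \<in> A"
  shows "1 \<le> hidden \<tau> j \<bullet> hidden \<tau> j" "hidden \<tau> j \<bullet> hidden \<tau> j \<le> 1 + 9 / 800"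
  using N_ge unfolding inner_hidden_hidden[OF assms] by (auto simp: field_simps)

lemma inner_decoy: "decoy \<tau> u i \<bullet> y = u \<bullet> y + 3 / 5 * (signs \<tau> $ i * y $ i)"
  by (simp add: decoy_def inner_add_left inner_axis')

lemma norm_sphere_A: "u \<in> sphere_A \<Longrightarrow> norm u = 3 / 4"
  by (simp only: sphere_A_def mem_Collect_eq)

lemma sphere_A_nth: "u \<in> sphere_A \<Longrightarrow> \<bar>u $ i\<bar> \<le> 3 / 4"
  unfolding sphere_A_def using component_le_norm_cart[of u i] by simp

lemma inner_sphere_A_signs: "u \<in> sphere_A \<Longrightarrow> signs \<tau> \<bullet> u = 0"
  unfolding inner_signs sphere_A_def by simp

lemma decoy_nth: "j \<in> A \<Longrightarrow> i \<notin> A \<Longrightarrow> decoy \<tau> u i $ j = u $ j"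
  by (auto simp: decoy_def axis_def)

lemma inner_signs_decoy:
  assumes "u \<in> sphere_A" "i \<notin> A"
  shows "signs \<tau> \<bullet> decoy \<tau> u i = 3 / 5"
  using assms signs_square[of i \<tau>]
  by (simp add: decoy_def inner_add_right inner_sphere_A_signs inner_axis mult_ac)

lemma inner_hidden_decoy:
  assumes "j \<in> A" "u \<in> sphere_A" "i \<notin> A"
  shows "hidden \<tau> j \<bullet> decoy \<tau> u i = u $ j + 9 / (50 * real N)"
  using assms by (simp add: inner_hidden decoy_nth inner_signs_decoy)

lemma inner_hidden_decoy_bounds:
  assumes "j \<in> A" "u \<in> sphere_A" "i \<notin> A"
  shows "u $ j \<le> hidden \<tau> j \<bullet> decoy \<tau> u i" "hidden \<tau> j \<bullet> decoy \<tau> u i \<le> u $ j + 9 / 400"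
  using N_ge unfolding inner_hidden_decoy[OF assms] by (auto simp: field_simps)

lemma inner_decoy_decoy:
  assumes "u \<in> sphere_A" "i \<notin> A"
  shows "decoy \<tau> u i \<bullet> decoy \<tau> u i = 369 / 400"
proof -
  have "u \<bullet> u = (norm u)\<^sup>2"
    by (rule power2_norm_eq_inner[symmetric])
  then have "u \<bullet> u = 9 / 16"
    unfolding norm_sphere_A[OF assms(1)] by (simp add: power2_eq_square)
  moreover have "u $ i = 0"
    using assms by (simp add: sphere_A_def)
  ultimately show ?thesis
    unfolding inner_decoy using signs_square[OF assms(2), of \<tau>]
    by (simp add: decoy_def inner_add_right inner_axis)
qed

lemma norm_decoys: "d \<in> decoys \<tau> \<Longrightarrow> d \<bullet> d = 369 / 400"
  by (auto simp: decoys_def inner_decoy_decoy)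

section \<open>The nearest decoy and when it loses to the hidden vertex\<close>

lemma inner_sphere_A_le:
  assumes "u \<in> sphere_A"
  shows "u \<bullet> y \<le> 3 / 4 * norm (part_A y)"
proof -
  have "u \<bullet> y = u \<bullet> part_A y"
    using assms by (auto simp: inner_vec_def part_A_def sphere_A_def intro!: sum.cong)
  also have "\<dots> \<le> norm u * norm (part_A y)"
    by (rule norm_cauchy_schwarz)
  finally show ?thesis
    using norm_sphere_A[OF assms] by simp
qed

lemma direction_in_sphere_A: "direction y \<in> sphere_A"
proof -
  have "axis j (3 / 4) = (3 / 4) *\<^sub>R (axis j 1 :: real^'n)" for j
    by (simp add: vec_eq_iff axis_def)
  then have "norm (axis j (3 / 4) :: real^'n) = 3 / 4" for j
    by simp
  moreover have "(SOME j. j \<in> A) \<in> A"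
    using some_in_eq[of A] A_nonempty by blast
  ultimately show ?thesis
    unfolding direction_def sphere_A_def by (auto simp: axis_def part_A_def)
qed

text \<open>This is the equality case of the Cauchy-Schwarz bound \<open>inner_sphere_A_le\<close>;
  if \<open>part_A y = 0\<close>, both sides vanish whatever axis was chosen.\<close>

lemma inner_direction: "direction y \<bullet> y = 3 / 4 * norm (part_A y)"
proof (cases "part_A y = 0")
  case True
  moreover have "(SOME j. j \<in> A) \<in> A"
    using some_in_eq[of A] A_nonempty by blast
  with True have "y $ (SOME j. j \<in> A) = 0"
    by (simp add: part_A_def vec_eq_iff) metis
  ultimately show ?thesis
    by (simp add: direction_def inner_axis')
next
  case False
  have "part_A y \<bullet> y = part_A y \<bullet> part_A y"
    by (auto simp: inner_vec_def part_A_def intro!: sum.cong)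
  also have "\<dots> = norm (part_A y) * norm (part_A y)"
    by (simp add: power2_norm_eq_inner[symmetric] power2_eq_square)
  finally show ?thesis
    using False by (simp add: direction_def)
qed

lemma best_sign:
  "best_sign \<tau> y \<notin> A \<and>
    (\<forall>l. l \<notin> A \<longrightarrow> signs \<tau> $ l * y $ l \<le> signs \<tau> $ best_sign \<tau> y * y $ best_sign \<tau> y)"
  unfolding best_sign_def
proof (rule someI_ex)
  let ?g = "\<lambda>i. signs \<tau> $ i * y $ i"
  have "Max (?g ` (- A)) \<in> ?g ` (- A)"
    using compl_A_nonempty by (intro Max_in) auto
  then obtain i where "i \<notin> A" "?g i = Max (?g ` (- A))"
    by auto
  then show "\<exists>i. i \<notin> A \<and> (\<forall>l. l \<notin> A \<longrightarrow> ?g l \<le> ?g i)"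
    by (intro exI[of _ i]) auto
qed

lemma decoy_oracle_in_decoys: "decoy_oracle \<tau> y \<in> decoys \<tau>"
  using direction_in_sphere_A[of y] best_sign[of \<tau> y]
  by (auto simp only: decoy_oracle_def decoys_def)

text \<open>The inner product splits into a term in \<open>u\<close> and a term in \<open>i\<close>,
  maximized separately by \<open>direction\<close> and \<open>best_sign\<close>. Since all decoys
  have the same norm, this makes \<open>decoy_oracle\<close> a nearest-decoy map.\<close>

lemma inner_decoy_oracle: "d \<in> decoys \<tau> \<Longrightarrow> d \<bullet> y \<le> decoy_oracle \<tau> y \<bullet> y"
  using best_sign[of \<tau> y]
  by (auto simp only: decoys_def decoy_oracle_def inner_decoy inner_direction mem_Collect_eq
      intro!: add_mono mult_left_mono inner_sphere_A_le)

text \<open>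
  A query exposes the hidden vertex only if it lies on the wrong side of every sign of \<open>\<tau>\<close>,
  or if a single coordinate in \<open>A\<close> dominates it.
\<close>

lemma proj_hard_instance_cases:
  assumes j: "j \<in> A" and neq: "proj (hard_instance \<tau> j) y \<noteq> decoy_oracle \<tau> y"
  shows "(\<forall>i. i \<notin> A \<longrightarrow> signs \<tau> $ i * y $ i < 0) \<or> 3 / 4 * norm (part_A y) < y $ j"
proof (rule disjCI)
  assume not_dominated: "\<not> 3 / 4 * norm (part_A y) < y $ j"
  define M where "M = signs \<tau> $ best_sign \<tau> y * y $ best_sign \<tau> y"
  define P where "P = 3 / (10 * real N) * (signs \<tau> \<bullet> y)"
  have "norm (hidden \<tau> j - y) < norm (decoy_oracle \<tau> y - y)"
    using neq by (auto simp: hard_instance_def split: if_splits)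
  moreover have "decoy_oracle \<tau> y \<bullet> y = 3 / 4 * norm (part_A y) + 3 / 5 * M"
    by (simp add: decoy_oracle_def inner_decoy inner_direction M_def)
  ultimately have "hidden \<tau> j \<bullet> hidden \<tau> j - 2 * (y $ j + P)
      < 369 / 400 - 2 * (3 / 4 * norm (part_A y) + 3 / 5 * M)"
    unfolding norm_diff_less_iff norm_decoys[OF decoy_oracle_in_decoys]
    by (simp add: inner_hidden[of _ _ y] P_def)
  \<comment> \<open>The hidden vertex sees the average of the signed coordinates of
    \<open>y\<close>, a decoy sees their maximum \<open>M\<close>.\<close>
  moreover have "P \<le> 3 / 10 * M"
  proof -
    have "(\<Sum>i\<in>-A. signs \<tau> $ i * y $ i) \<le> real (card (- A)) * M"
      unfolding M_def using best_sign[of \<tau> y] by (intro sum_bounded_above) auto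
    then have "signs \<tau> \<bullet> y \<le> real N * M"
      by (simp add: inner_signs card_compl)
    then have "P \<le> 3 / (10 * real N) * (real N * M)"
      unfolding P_def by (rule mult_left_mono) simp
    then show ?thesis
      using N_pos by simp
  qed
  \<comment> \<open>The hidden vertex is longer, gains nothing on \<open>A\<close>, and has weight
    3/10 against 3/5 on \<open>M\<close>; it can be closer only if \<open>M\<close> is
    negative.\<close>
  ultimately have "M < 0"
    using not_dominated inner_hidden_hidden_bounds(1)[OF j, of \<tau>] by argo
  then show "\<forall>i. i \<notin> A \<longrightarrow> signs \<tau> $ i * y $ i < 0"
    using best_sign[of \<tau> y] unfolding M_def
    by (meson le_less_trans)
qed

lemma compact_decoys: "compact (decoys \<tau>)"
proof -
  have "sphere_A = sphere 0 (3 / 4) \<inter> (\<Inter>i\<in>-A. {u. u $ i = 0})"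
    by (auto simp: sphere_A_def)
  moreover have "closed (\<Inter>i\<in>-A. {u :: real^'n. u $ i = 0})"
    by (intro closed_INT ballI closed_Collect_eq continuous_intros)
  ultimately have "compact sphere_A"
    by (simp add: compact_Int_closed)
  then have "compact (\<Union>i\<in>-A. (\<lambda>u. u + axis i (3 / 5 * signs \<tau> $ i)) ` sphere_A)"
    by (intro compact_UN compact_continuous_image continuous_intros) auto
  also have "(\<Union>i\<in>-A. (\<lambda>u. u + axis i (3 / 5 * signs \<tau> $ i)) ` sphere_A) = decoys \<tau>"
    by (auto simp: decoys_def decoy_def)
  finally show ?thesis .
qed

lemma decoys_nonempty: "decoys \<tau> \<noteq> {}"
  using decoy_oracle_in_decoys by blast

section \<open>Optimality gap of the hidden vertex\<close>

lemma abs_convex_hull_decoys_nth: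
  assumes "b \<in> convex hull decoys \<tau>" and "j \<in> A"
  shows "\<bar>b $ j\<bar> \<le> 3 / 4"
proof -
  have "decoys \<tau> \<subseteq> {x. axis j 1 \<bullet> x \<le> 3 / 4} \<inter> {x. axis j 1 \<bullet> x \<ge> - 3 / 4}"
    using sphere_A_nth[of _ j] \<open>j \<in> A\<close> by (fastforce simp: decoys_def decoy_nth inner_axis')
  then have "convex hull decoys \<tau>
      \<subseteq> {x. axis j 1 \<bullet> x \<le> 3 / 4} \<inter> {x. axis j 1 \<bullet> x \<ge> - 3 / 4}"
    by (intro hull_minimal convex_Int convex_halfspace_le convex_halfspace_ge)
  with assms(1) have "b \<in> {x. axis j 1 \<bullet> x \<le> 3 / 4} \<inter> {x. axis j 1 \<bullet> x \<ge> - 3 / 4}"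
    by blast
  then have "b $ j \<le> 3 / 4" "- (3 / 4) \<le> b $ j"
    by (auto simp: inner_axis')
  then show ?thesis
    by linarith
qed

text \<open>This is the gradient of \<open>obj\<close> at the hidden vertex.\<close>

definition hidden_grad :: "'n set \<Rightarrow> 'n \<Rightarrow> real^'n" where
  "hidden_grad \<tau> j = (\<chi> i. (if i \<in> A then \<alpha> else \<beta>) * hidden \<tau> j $ i)"

lemma inner_hidden_grad:
  assumes "j \<in> A"
  shows "hidden_grad \<tau> j \<bullet> y = \<alpha> * y $ j + \<beta> * (3 / (10 * real N)) * (signs \<tau> \<bullet> y)"
proof -
  have "hidden_grad \<tau> j = \<alpha> *\<^sub>R axis j 1 + (\<beta> * (3 / (10 * real N))) *\<^sub>R signs \<tau>"
    using assms by (auto simp: hidden_grad_def hidden_def vec_eq_iff signs_def axis_def)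
  then show ?thesis
    by (simp add: inner_add_left inner_axis')
qed

text \<open>With c = \<open>\<beta> * (9 / (100 * real N))\<close>, the signs contribute 2c at a
  decoy but only c at the hidden vertex. Since \<beta> is at least 32 N \<alpha>, c is at least 2.88
  \<alpha>, whereas coordinate \<open>j\<close> favours a decoy by at most (1 + 3/4) \<alpha>. A
  linear bound on the decoys passes to their hull.\<close>

lemma hidden_grad_convex_hull_decoys:
  assumes j: "j \<in> A" and "b \<in> convex hull decoys \<tau>"
  shows "\<alpha> \<le> hidden_grad \<tau> j \<bullet> (b - hidden \<tau> j)"
proof -
  have \<beta>N: "288 / 100 * \<alpha> \<le> \<beta> * (9 / (100 * real N))"
    using \<beta>_ge N_pos by (simp add: field_simps)
  have sh: "signs \<tau> \<bullet> hidden \<tau> j = 3 / 10"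
    using j N_pos by (simp add: hidden_def inner_add_right inner_axis inner_signs_signs signs_nth)
  then have hid: "hidden_grad \<tau> j \<bullet> hidden \<tau> j = \<alpha> + \<beta> * (9 / (100 * real N))"
    unfolding inner_hidden_grad[OF j] sh using j by (simp add: hidden_nth)
  have "hidden_grad \<tau> j \<bullet> hidden \<tau> j + \<alpha> \<le> hidden_grad \<tau> j \<bullet> decoy \<tau> u i"
    if u: "u \<in> sphere_A" and i: "i \<notin> A" for u i
  proof -
    have "hidden_grad \<tau> j \<bullet> decoy \<tau> u i = \<alpha> * u $ j + 2 * (\<beta> * (9 / (100 * real N)))"
      using j u i by (simp add: inner_hidden_grad decoy_nth inner_signs_decoy)
    moreover have "\<alpha> * (- (3 / 4)) \<le> \<alpha> * u $ j"
      using sphere_A_nth[OF u, of j] \<alpha>_pos by (intro mult_left_mono) auto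
    ultimately show ?thesis
      unfolding hid using \<beta>N \<alpha>_pos by linarith
  qed
  then have "decoys \<tau> \<subseteq> {x. hidden_grad \<tau> j \<bullet> x \<ge> hidden_grad \<tau> j \<bullet> hidden \<tau> j + \<alpha>}"
    by (auto simp: decoys_def)
  then have "convex hull decoys \<tau>
      \<subseteq> {x. hidden_grad \<tau> j \<bullet> x \<ge> hidden_grad \<tau> j \<bullet> hidden \<tau> j + \<alpha>}"
    by (intro hull_minimal convex_halfspace_ge)
  with assms(2) show ?thesis
    by (auto simp: inner_diff_right)
qed

text \<open>The feasible set is a union of segments from the hidden vertex to the decoy hull. Along
  each of them the tangent inequality charges at least \<alpha> per unit of
  \<open>\<mu>\<close>.\<close>

lemma feasible_hard_instance_cases:
  assumes "j \<in> A" and "x \<in> feasible (hard_instance \<tau> j)"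
  obtains \<mu> b where "0 \<le> \<mu>" "\<mu> \<le> 1" "b \<in> convex hull decoys \<tau>"
    "x = (1 - \<mu>) *\<^sub>R hidden \<tau> j + \<mu> *\<^sub>R b" "obj (hidden \<tau> j) + \<mu> * \<alpha> \<le> obj x"
proof -
  from assms(2) obtain \<mu> b where *: "0 \<le> \<mu>" "\<mu> \<le> 1" "b \<in> convex hull decoys \<tau>"
    "x = (1 - \<mu>) *\<^sub>R hidden \<tau> j + \<mu> *\<^sub>R b"
    using decoys_nonempty by (auto simp: hard_instance_def elim: convex_hull_insert_cases)
  have "obj (hidden \<tau> j) + hidden_grad \<tau> j \<bullet> (x - hidden \<tau> j) \<le> obj x"
    unfolding obj_def hidden_grad_def
    using \<alpha>_pos \<alpha>_le_\<beta> by (intro diagonal_quadratic_ge_tangent) auto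
  moreover have "x - hidden \<tau> j = \<mu> *\<^sub>R (b - hidden \<tau> j)"
    using * by (simp add: algebra_simps)
  moreover have "\<mu> * \<alpha> \<le> \<mu> * (hidden_grad \<tau> j \<bullet> (b - hidden \<tau> j))"
    using * assms(1) hidden_grad_convex_hull_decoys by (intro mult_left_mono) auto
  ultimately have "obj (hidden \<tau> j) + \<mu> * \<alpha> \<le> obj x"
    by simp
  with * show thesis by (rule that)
qed

definition solved :: "'n set \<Rightarrow> 'n \<Rightarrow> real^'n \<Rightarrow> bool" where
  "solved \<tau> j x \<longleftrightarrow> x \<in> feasible (hard_instance \<tau> j) \<and> obj x < obj (hidden \<tau> j) + \<alpha> / 4"

text \<open>Error below \<alpha>/4 forces weight above 3/4 on the hidden vertex. The decoy part
  moves coordinate \<open>j\<close> by at most 3/16, so that coordinate is at least 9/16 if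
  \<open>j\<close> is solved and at most 3/16 if another index is.\<close>

lemma solved_unique:
  assumes "solved \<tau> j x" "solved \<tau> k x" "j \<in> A" "k \<in> A"
  shows "j = k"
proof (rule ccontr)
  assume "j \<noteq> k"
  have 1: "\<exists>\<mu> b. 0 \<le> \<mu> \<and> \<mu> < 1 / 4 \<and> b \<in> convex hull decoys \<tau> \<and> x = (1 - \<mu>) *\<^sub>R hidden \<tau> l + \<mu> *\<^sub>R b"
    if "solved \<tau> l x" "l \<in> A" for l
  proof -
    have "x \<in> feasible (hard_instance \<tau> l)" and x: "obj x < obj (hidden \<tau> l) + \<alpha> / 4"
      using that(1) by (auto simp: solved_def)
    from \<open>l \<in> A\<close> this(1) obtain \<mu> b where *: "0 \<le> \<mu>" "b \<in> convex hull decoys \<tau>"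
      "x = (1 - \<mu>) *\<^sub>R hidden \<tau> l + \<mu> *\<^sub>R b" "obj (hidden \<tau> l) + \<mu> * \<alpha> \<le> obj x"
      by (rule feasible_hard_instance_cases)
    then have "\<mu> * \<alpha> < 1 / 4 * \<alpha>"
      using x by simp
    then have "\<mu> < 1 / 4"
      using \<alpha>_pos by (simp only: mult_less_cancel_right_pos)
    with * show ?thesis by blast
  qed
  have bound: "\<mu> * (b $ j) \<le> 3 / 16 \<and> - (3 / 16) \<le> \<mu> * (b $ j)"
    if "0 \<le> \<mu>" "\<mu> < 1 / 4" "b \<in> convex hull decoys \<tau>" for \<mu> b
  proof -
    have "\<bar>\<mu> * (b $ j)\<bar> \<le> 1 / 4 * (3 / 4)"
      unfolding abs_mult using that abs_convex_hull_decoys_nth[OF that(3) \<open>j \<in> A\<close>]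
      by (intro mult_mono) auto
    then show ?thesis by linarith
  qed
  obtain \<mu> b where "0 \<le> \<mu>" "\<mu> < 1 / 4" "b \<in> convex hull decoys \<tau>"
    "x = (1 - \<mu>) *\<^sub>R hidden \<tau> j + \<mu> *\<^sub>R b"
    using 1[of j] assms by blast
  then have "x $ j \<ge> 9 / 16"
    using bound[of \<mu> b] \<open>j \<in> A\<close> by (simp add: hidden_nth)
  moreover obtain \<mu>' b' where "0 \<le> \<mu>'" "\<mu>' < 1 / 4" "b' \<in> convex hull decoys \<tau>"
    "x = (1 - \<mu>') *\<^sub>R hidden \<tau> k + \<mu>' *\<^sub>R b'"
    using 1[of k] assms by blast
  then have "x $ j \<le> 3 / 16"
    using bound[of \<mu>' b'] \<open>j \<in> A\<close> \<open>j \<noteq> k\<close> by (simp add: hidden_nth)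
  ultimately show False by simp
qed

section \<open>Admissibility of the hard instances\<close>

lemma vertices_hard_instance:
  assumes j: "j \<in> A"
  shows "vertices (feasible (hard_instance \<tau> j)) = insert (hidden \<tau> j) (decoys \<tau>)"
proof -
  let ?V = "insert (hidden \<tau> j) (decoys \<tau>)"
  have "{x. x extreme_point_of (convex hull ?V)} = ?V"
  proof (rule extreme_points_of_convex_hull_strictly_supported)
    show "compact ?V"
      using compact_decoys by (rule compact_insert)
    fix v assume v: "v \<in> ?V"
    show "\<exists>y. \<forall>x\<in>?V - {v}. y \<bullet> x < y \<bullet> v"
    proof (cases "v = hidden \<tau> j")
      case True
      \<comment> \<open>The hidden vertex is exposed by the negative gradient.\<close>
      have "\<alpha> \<le> hidden_grad \<tau> j \<bullet> (x - hidden \<tau> j)" if "x \<in> decoys \<tau>" for x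
        using that j by (intro hidden_grad_convex_hull_decoys hull_inc)
      then show ?thesis
        using True \<alpha>_pos by (intro exI[of _ "- hidden_grad \<tau> j"]) (fastforce simp: inner_diff_right)
    next
      case False
      with v have d: "v \<in> decoys \<tau>" by simp
      \<comment> \<open>A decoy is exposed by itself: the other decoys lie on the same sphere around
        0, and the hidden vertex has inner product at most 3/4 + 9/400 = 309/400 with it, below
        369/400.\<close>
      have "v \<bullet> x < v \<bullet> v" if x: "x \<in> ?V" "x \<noteq> v" for x
      proof (cases "x = hidden \<tau> j")
        case True
        obtain u i where ui: "u \<in> sphere_A" "i \<notin> A" "v = decoy \<tau> u i"
          using d unfolding decoys_def by blast
        have "v \<bullet> x \<le> u $ j + 9 / 400"
          using inner_hidden_decoy_bounds(2)[OF j ui(1,2), of \<tau>] True ui(3)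
          by (simp add: inner_commute)
        then show ?thesis
          using norm_decoys[OF d] sphere_A_nth[OF ui(1), of j] by linarith
      next
        case False
        with x have x': "x \<in> decoys \<tau>" by simp
        have "0 < (v - x) \<bullet> (v - x)"
          using x by simp
        also have "\<dots> = v \<bullet> v + x \<bullet> x - 2 * (v \<bullet> x)"
          by (simp add: inner_diff_left inner_diff_right inner_commute)
        finally show ?thesis
          using norm_decoys[OF d] norm_decoys[OF x'] by simp
      qed
      then show ?thesis by blast
    qed
  qed
  then show ?thesis
    by (simp add: vertices_def hard_instance_def)
qed

lemma diameter_hard_instance:
  assumes j: "j \<in> A"
  shows "diameter (feasible (hard_instance \<tau> j)) \<le> 2"
  unfolding hard_instance_def problem.simps
proof (rule diameter_convex_hull_le)
  have norm_le: "dist x y \<le> 2" if "x \<bullet> x + y \<bullet> y - 2 * (x \<bullet> y) \<le> 4" for x y :: "real^'n"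
  proof -
    have "(dist x y)\<^sup>2 \<le> 2\<^sup>2"
      using that unfolding dist_norm power2_norm_eq_inner
      by (simp add: inner_diff_left inner_diff_right inner_commute)
    then show ?thesis by (rule power2_le_imp_le) simp
  qed
  have dd: "dist x y \<le> 2" if "x \<in> decoys \<tau>" "y \<in> decoys \<tau>" for x y
  proof (rule norm_le)
    \<comment> \<open>This bounds the squared distance by twice the sum of the squared norms, which
      is 3.69.\<close>
    have "0 \<le> (x + y) \<bullet> (x + y)" by simp
    then show "x \<bullet> x + y \<bullet> y - 2 * (x \<bullet> y) \<le> 4"
      using norm_decoys[OF that(1)] norm_decoys[OF that(2)]
      by (simp add: inner_add_left inner_add_right inner_commute)
  qed
  have hd: "dist (hidden \<tau> j) x \<le> 2" if x: "x \<in> decoys \<tau>" for x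
  proof (rule norm_le)
    obtain u i where ui: "u \<in> sphere_A" "i \<notin> A" "x = decoy \<tau> u i"
      using x unfolding decoys_def by blast
    show "hidden \<tau> j \<bullet> hidden \<tau> j + x \<bullet> x - 2 * (hidden \<tau> j \<bullet> x) \<le> 4"
      using inner_hidden_hidden_bounds(2)[OF j, of \<tau>] norm_decoys[OF x] sphere_A_nth[OF ui(1), of j]
        inner_hidden_decoy_bounds(1)[OF j ui(1,2), of \<tau>, folded ui(3)]
      by linarith
  qed
  show "dist x y \<le> 2"
    if "x \<in> insert (hidden \<tau> j) (decoys \<tau>)" "y \<in> insert (hidden \<tau> j) (decoys \<tau>)" for x y
    using that dd hd by (auto simp: dist_commute)
qed simp

lemma sparse_projection_hard_instance:
  assumes j: "j \<in> A"
  shows "sparse_projection (feasible (hard_instance \<tau> j)) (proj (hard_instance \<tau> j))"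
proof -
  have le: "norm (decoy_oracle \<tau> y - y) \<le> norm (d - y)" if "d \<in> decoys \<tau>" for d y
    using inner_decoy_oracle[OF that, of y] norm_decoys[OF that]
      norm_decoys[OF decoy_oracle_in_decoys[of \<tau> y]] norm_diff_less_iff[of d y "decoy_oracle \<tau> y"]
    by linarith
  show ?thesis
    unfolding sparse_projection_def is_arg_min_def vertices_hard_instance[OF j]
  proof (intro allI conjI)
    fix y
    show "proj (hard_instance \<tau> j) y \<in> insert (hidden \<tau> j) (decoys \<tau>)"
      using decoy_oracle_in_decoys by (simp add: hard_instance_def)
    have "norm (proj (hard_instance \<tau> j) y - y) \<le> norm (hidden \<tau> j - y)"
      and "norm (proj (hard_instance \<tau> j) y - y) \<le> norm (decoy_oracle \<tau> y - y)"
      by (auto simp: hard_instance_def)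
    then have "norm (proj (hard_instance \<tau> j) y - y) \<le> norm (z - y)"
      if "z \<in> insert (hidden \<tau> j) (decoys \<tau>)" for z
      using that le[of z y] by auto
    then show "\<not> (\<exists>z. z \<in> insert (hidden \<tau> j) (decoys \<tau>) \<and>
        norm (z - y) < norm (proj (hard_instance \<tau> j) y - y))"
      by (meson not_less)
  qed
qed

lemma hard_instance_admissible:
  assumes j: "j \<in> A"
  shows "admissible \<alpha> \<beta> (hard_instance \<tau> j) (hidden \<tau> j)"
  unfolding admissible_def
proof (intro conjI)
  have obj: "objective (hard_instance \<tau> j) = obj"
    by (simp add: hard_instance_def)
  show "quadratic (objective (hard_instance \<tau> j))"
    unfolding obj obj_def by (rule quadratic_diagonal_quadratic)
  show "strongly_convex \<alpha> (objective (hard_instance \<tau> j))"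
    unfolding obj obj_def using \<alpha>_le_\<beta> by (intro strongly_convex_diagonal_quadratic) auto
  show "smooth \<beta> (objective (hard_instance \<tau> j))"
    unfolding obj obj_def using \<alpha>_pos \<alpha>_le_\<beta> by (intro smooth_diagonal_quadratic) auto
  show "compact (feasible (hard_instance \<tau> j))"
    using compact_decoys by (auto simp: hard_instance_def intro!: compact_convex_hull compact_insert)
  show "convex (feasible (hard_instance \<tau> j))"
    by (simp add: hard_instance_def)
  show "diameter (feasible (hard_instance \<tau> j)) \<le> 2"
    using j by (rule diameter_hard_instance)
  show "sparse_projection (feasible (hard_instance \<tau> j)) (proj (hard_instance \<tau> j))"
    using j by (rule sparse_projection_hard_instance)
  show "hidden \<tau> j \<in> vertices (feasible (hard_instance \<tau> j))"
    using vertices_hard_instance[OF j] by simp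
  have feas: "hidden \<tau> j \<in> feasible (hard_instance \<tau> j)"
    by (simp add: hard_instance_def hull_inc)
  show "{w. is_arg_min (objective (hard_instance \<tau> j)) (\<lambda>z. z \<in> feasible (hard_instance \<tau> j)) w}
      = {hidden \<tau> j}"
    unfolding obj
  proof (intro set_eqI iffI)
    fix w assume "w \<in> {hidden \<tau> j}"
    moreover have "obj (hidden \<tau> j) \<le> obj z" if "z \<in> feasible (hard_instance \<tau> j)" for z
    proof -
      from j that obtain \<mu> where "0 \<le> \<mu>" "obj (hidden \<tau> j) + \<mu> * \<alpha> \<le> obj z"
        by (rule feasible_hard_instance_cases)
      moreover from this(1) \<alpha>_pos have "0 \<le> \<mu> * \<alpha>" by simp
      ultimately show ?thesis by linarith
    qed
    ultimately show "w \<in> {w. is_arg_min obj (\<lambda>z. z \<in> feasible (hard_instance \<tau> j)) w}"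
      using feas by (auto simp: is_arg_min_def not_less)
  next
    fix w assume w: "w \<in> {w. is_arg_min obj (\<lambda>z. z \<in> feasible (hard_instance \<tau> j)) w}"
    then have "w \<in> feasible (hard_instance \<tau> j)"
      by (simp add: is_arg_min_def)
    with j obtain \<mu> b where \<mu>: "0 \<le> \<mu>" "w = (1 - \<mu>) *\<^sub>R hidden \<tau> j + \<mu> *\<^sub>R b"
      "obj (hidden \<tau> j) + \<mu> * \<alpha> \<le> obj w"
      by (rule feasible_hard_instance_cases)
    have "obj w \<le> obj (hidden \<tau> j)"
      using w feas by (auto simp: is_arg_min_def not_less)
    \<comment> \<open>A second minimizer would have no room for the charge
      \<open>\<mu> * \<alpha>\<close>, so it sits at the hidden end of its segment.\<close>
    with \<mu> have "\<mu> * \<alpha> \<le> 0" by simp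
    with \<mu>(1) \<alpha>_pos have "\<mu> = 0"
      by (simp add: mult_le_0_iff)
    with \<mu>(2) show "w \<in> {hidden \<tau> j}" by simp
  qed
qed

end

section \<open>Counting the solved instances\<close>

primrec projection_queries :: "'v::real_inner problem \<Rightarrow> 'v strategy \<Rightarrow> 'v list" where
  "projection_queries I (Return w) = []"
| "projection_queries I (First_Order w k) =
     projection_queries I (k (objective I w, gradient (objective I) w))"
| "projection_queries I (Project y k) = y # projection_queries I (k (proj I y))"

text \<open>As long as the answers agree, both runs ask the same questions. The call bound is
  required for \<open>I\<close> only, while the queries are read off the run on \<open>J\<close>,
  which is not known in advance to stop within \<open>T\<close> calls; hence the truncation.\<close>

lemma run_output_cong:
  assumes "objective I = objective J"
    and "projection_calls I s \<le> T"
    and "\<forall>y\<in>set (take T (projection_queries J s)). proj I y = proj J y"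
  shows "run_output I s = run_output J s"
  using assms(2,3)
proof (induction s arbitrary: T)
  case (Return w)
  then show ?case by simp
next
  case (First_Order w k)
  then show ?case
    using assms(1) by (auto intro!: First_Order.IH)
next
  case (Project y k)
  then obtain T' where T: "T = Suc T'"
    by (cases T) auto
  then have "proj I y = proj J y"
    using Project.prems(2) by simp
  with T Project.prems show ?case
    by (auto intro!: Project.IH[of _ T'])
qed

context hidden_vertex
begin

text \<open>The reference instance without a hidden vertex: a run on it cannot depend on
  \<open>j\<close>.\<close>

definition decoy_instance :: "'n set \<Rightarrow> (real^'n) problem" where
  "decoy_instance \<tau> =
     \<lparr>objective = obj, feasible = convex hull decoys \<tau>, proj = decoy_oracle \<tau>\<rparr>"

definition opposite_signs :: "real^'n \<Rightarrow> 'n set set" where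
  "opposite_signs y = {\<tau> \<in> Pow (- A). \<forall>i. i \<notin> A \<longrightarrow> signs \<tau> $ i * y $ i < 0}"

text \<open>Patterns that the reference run may betray for all \<open>j\<close> at once. They are
  treated as lost in the count.\<close>

definition unmasked :: "(real^'n) strategy \<Rightarrow> nat \<Rightarrow> 'n set set" where
  "unmasked s T =
     {\<tau> \<in> Pow (- A). \<exists>y\<in>set (take T (projection_queries (decoy_instance \<tau>) s)). \<tau> \<in> opposite_signs y}"

text \<open>The query determines the pattern: it consists of the coordinates outside
  \<open>A\<close> where \<open>y\<close> is negative.\<close>

lemma card_opposite_signs: "card (opposite_signs y) \<le> 1"
proof -
  have "\<tau> = {i. i \<notin> A \<and> y $ i < 0}" if "\<tau> \<in> opposite_signs y" for \<tau>
  proof (intro set_eqI iffI)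
    fix i assume "i \<in> \<tau>"
    moreover from this have "i \<notin> A"
      using that by (auto simp: opposite_signs_def)
    ultimately show "i \<in> {i. i \<notin> A \<and> y $ i < 0}"
      using that by (auto simp: opposite_signs_def signs_def)
  next
    fix i assume "i \<in> {i. i \<notin> A \<and> y $ i < 0}"
    then have i: "i \<notin> A" "y $ i < 0" by auto
    then have "signs \<tau> $ i * y $ i < 0"
      using that unfolding opposite_signs_def by blast
    with i show "i \<in> \<tau>"
      by (auto simp: signs_def split: if_splits)
  qed
  then have "opposite_signs y \<subseteq> {{i. i \<notin> A \<and> y $ i < 0}}"
    by blast
  from card_mono[OF _ this] show ?thesis by simp
qed

text \<open>\<open>direction y\<close> does not depend on \<open>\<tau>\<close>, so over all
  patterns only the signed axis varies.\<close>

definition decoy_answers :: "real^'n \<Rightarrow> (real^'n) set" where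
  "decoy_answers y = (\<lambda>(i, c). direction y + axis i c) ` ((- A) \<times> {3 / 5, - 3 / 5})"

lemma decoy_oracle_in_answers: "decoy_oracle \<tau> y \<in> decoy_answers y"
  using best_sign[of \<tau> y]
  by (auto simp: decoy_oracle_def decoy_def decoy_answers_def signs_def image_iff)

lemma finite_decoy_answers: "finite (decoy_answers y)"
  by (simp add: decoy_answers_def)

lemma card_decoy_answers: "card (decoy_answers y) \<le> 2 * N"
proof -
  have "card (decoy_answers y) \<le> card ((- A) \<times> {3 / 5, - 3 / 5 :: real})"
    unfolding decoy_answers_def by (rule card_image_le) simp
  then show ?thesis
    by (simp add: card_cartesian_product card_compl)
qed

text \<open>
  For given \<open>y\<close> the decoy oracle has only \<open>2N\<close> possible answers, so at most \<open>(2N)\<^sup>t\<close> different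
  points can be query number \<open>t + 1\<close>, and each of them unmasks at most one \<open>\<tau>\<close>.
\<close>

lemma card_unmasked: "card (unmasked s T) < (2 * N) ^ T"
proof (induction s arbitrary: T)
  case (Return w)
  then show ?case
    using N_ge by (simp add: unmasked_def)
next
  case (First_Order w k)
  have "unmasked (First_Order w k) T = unmasked (k (obj w, gradient obj w)) T"
    by (simp add: unmasked_def decoy_instance_def)
  then show ?case
    using First_Order.IH by simp
next
  case (Project y k)
  show ?case
  proof (cases T)
    case 0
    then show ?thesis by (simp add: unmasked_def)
  next
    case (Suc T')
    \<comment> \<open>A pattern is betrayed either by \<open>y\<close> itself or in the continuation
      after its own answer, which is one of the \<open>decoy_answers y\<close>.\<close>
    have "unmasked (Project y k) T \<subseteq> opposite_signs y \<union> (\<Union>a\<in>decoy_answers y. unmasked (k a) T')"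
      using Suc decoy_oracle_in_answers by (fastforce simp: unmasked_def decoy_instance_def)
    then have "card (unmasked (Project y k) T)
        \<le> card (opposite_signs y \<union> (\<Union>a\<in>decoy_answers y. unmasked (k a) T'))"
      by (intro card_mono) auto
    also have "\<dots> \<le> card (opposite_signs y) + card (\<Union>a\<in>decoy_answers y. unmasked (k a) T')"
      by (rule card_Un_le)
    also have "card (\<Union>a\<in>decoy_answers y. unmasked (k a) T')
        \<le> (\<Sum>a\<in>decoy_answers y. card (unmasked (k a) T'))"
      using finite_decoy_answers by (rule card_UN_le)
    also have "\<dots> \<le> of_nat (card (decoy_answers y)) * ((2 * N) ^ T' - 1)"
    proof (rule sum_bounded_above)
      fix a
      have "card (unmasked (k a) T') < (2 * N) ^ T'"
        by (intro Project.IH rangeI)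
      then show "card (unmasked (k a) T') \<le> (2 * N) ^ T' - 1"
        by simp
    qed
    also have "\<dots> \<le> 2 * N * ((2 * N) ^ T' - 1)"
      using card_decoy_answers by (intro mult_right_mono) auto
    \<comment> \<open>The strict form of the induction hypothesis saves 2N, more than the 1 spent on
      the query \<open>y\<close>.\<close>
    finally have "card (unmasked (Project y k) T) \<le> 1 + 2 * N * ((2 * N) ^ T' - 1)"
      using card_opposite_signs[of y] by simp
    moreover have "2 * N * 1 \<le> 2 * N * (2 * N) ^ T'"
      using N_ge by (intro mult_left_mono) auto
    ultimately show ?thesis
      using N_ge unfolding Suc power_Suc diff_mult_distrib2 by linarith
  qed
qed

text \<open>Two such coordinates would have squares summing to more than 9/8 of the squared norm of
  \<open>part_A y\<close>.\<close>

lemma card_dominated: "card {j \<in> A. 3 / 4 * norm (part_A y) < y $ j} \<le> 1"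
proof -
  have "j = k" if j: "j \<in> A" "3 / 4 * norm (part_A y) < y $ j"
    and k: "k \<in> A" "3 / 4 * norm (part_A y) < y $ k" for j k
  proof (rule ccontr)
    assume "j \<noteq> k"
    then have "(y $ j)\<^sup>2 + (y $ k)\<^sup>2 = (\<Sum>i\<in>{j, k}. (part_A y $ i)\<^sup>2)"
      using j k by (simp add: part_A_def)
    also have "\<dots> \<le> (\<Sum>i\<in>UNIV. (part_A y $ i)\<^sup>2)"
      by (rule sum_mono2) auto
    also have "\<dots> = (norm (part_A y))\<^sup>2"
      unfolding power2_norm_eq_inner by (simp add: inner_vec_def power2_eq_square)
    finally have le: "(y $ j)\<^sup>2 + (y $ k)\<^sup>2 \<le> (norm (part_A y))\<^sup>2" .
    have "(3 / 4 * norm (part_A y))\<^sup>2 < (y $ j)\<^sup>2" "(3 / 4 * norm (part_A y))\<^sup>2 < (y $ k)\<^sup>2"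
      using j k by (auto intro!: power_strict_mono)
    moreover have "(3 / 4 * norm (part_A y))\<^sup>2 = 9 / 16 * (norm (part_A y))\<^sup>2"
      by (simp add: power_mult_distrib power2_eq_square)
    moreover have "0 \<le> (norm (part_A y))\<^sup>2"
      by simp
    ultimately show False
      using le by linarith
  qed
  then have "\<forall>j\<in>{j \<in> A. 3 / 4 * norm (part_A y) < y $ j}.
      \<forall>k\<in>{j \<in> A. 3 / 4 * norm (part_A y) < y $ j}. j = k"
    by blast
  then show ?thesis
    using card_le_Suc0_iff_eq[of "{j \<in> A. 3 / 4 * norm (part_A y) < y $ j}"] by simp
qed

lemma card_solved_decoy: "card {j \<in> A. solved \<tau> j x} \<le> 1"
proof -
  have "\<forall>j\<in>{j \<in> A. solved \<tau> j x}. \<forall>k\<in>{j \<in> A. solved \<tau> j x}. j = k"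
    using solved_unique by blast
  then show ?thesis
    using card_le_Suc0_iff_eq[of "{j \<in> A. solved \<tau> j x}"] by simp
qed

text \<open>If \<open>j\<close> is solved, either one of the first \<open>T\<close> reference
  queries is dominated by its coordinate \<open>j\<close>, which accounts for at most
  \<open>T\<close> indices, or the output is that of the reference run, one point that solves at
  most one index.\<close>

lemma card_solved_masked:
  assumes \<tau>: "\<tau> \<in> Pow (- A)" "\<tau> \<notin> unmasked s T"
    and calls: "\<And>j. j \<in> A \<Longrightarrow> projection_calls (hard_instance \<tau> j) s \<le> T"
  shows "card {j \<in> A. solved \<tau> j (run_output (hard_instance \<tau> j) s)} \<le> Suc T"
proof -
  let ?Q = "set (take T (projection_queries (decoy_instance \<tau>) s))"
  let ?dom = "\<lambda>y. {j \<in> A. 3 / 4 * norm (part_A y) < y $ j}"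
  let ?guess = "{j \<in> A. solved \<tau> j (run_output (decoy_instance \<tau>) s)}"
  have "{j \<in> A. solved \<tau> j (run_output (hard_instance \<tau> j) s)} \<subseteq> (\<Union>y\<in>?Q. ?dom y) \<union> ?guess"
  proof
    fix j assume "j \<in> {j \<in> A. solved \<tau> j (run_output (hard_instance \<tau> j) s)}"
    then have j: "j \<in> A" "solved \<tau> j (run_output (hard_instance \<tau> j) s)"
      by auto
    show "j \<in> (\<Union>y\<in>?Q. ?dom y) \<union> ?guess"
    proof (cases "\<forall>y\<in>?Q. proj (hard_instance \<tau> j) y = proj (decoy_instance \<tau>) y")
      case True
      have "objective (hard_instance \<tau> j) = objective (decoy_instance \<tau>)"
        by (simp add: hard_instance_def decoy_instance_def)
      then have "run_output (hard_instance \<tau> j) s = run_output (decoy_instance \<tau>) s"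
        using calls[OF j(1)] True by (rule run_output_cong)
      with j show ?thesis by simp
    next
      case False
      then obtain y where y: "y \<in> ?Q" "proj (hard_instance \<tau> j) y \<noteq> decoy_oracle \<tau> y"
        by (auto simp: decoy_instance_def)
      moreover have "\<not> (\<forall>i. i \<notin> A \<longrightarrow> signs \<tau> $ i * y $ i < 0)"
        using \<tau> y(1) by (auto simp: unmasked_def opposite_signs_def)
      ultimately have "3 / 4 * norm (part_A y) < y $ j"
        using proj_hard_instance_cases[OF j(1)] by blast
      with y(1) j(1) show ?thesis by blast
    qed
  qed
  then have "card {j \<in> A. solved \<tau> j (run_output (hard_instance \<tau> j) s)}
      \<le> card ((\<Union>y\<in>?Q. ?dom y) \<union> ?guess)"
    by (intro card_mono) auto
  also have "\<dots> \<le> card (\<Union>y\<in>?Q. ?dom y) + card ?guess"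
    by (rule card_Un_le)
  also have "card (\<Union>y\<in>?Q. ?dom y) \<le> (\<Sum>y\<in>?Q. card (?dom y))"
    by (rule card_UN_le) simp
  also have "\<dots> \<le> of_nat (card ?Q) * 1"
    using card_dominated by (intro sum_bounded_above) auto
  also have "card ?Q \<le> T"
    by (rule order.trans[OF card_length]) simp
  finally show ?thesis
    using card_solved_decoy[of \<tau> "run_output (decoy_instance \<tau>) s"] by simp
qed

text \<open>For unmasked patterns every \<open>j\<close> is conceded; the remaining patterns, at
  most \<open>2 ^ N\<close>, concede \<open>Suc T\<close> indices each.\<close>

lemma card_solved:
  assumes calls: "\<And>\<tau> j. j \<in> A \<Longrightarrow> projection_calls (hard_instance \<tau> j) s \<le> T"
  shows "card {(\<tau>, j) \<in> Pow (- A) \<times> A. solved \<tau> j (run_output (hard_instance \<tau> j) s)}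
      \<le> (2 * N) ^ T * N + 2 ^ N * Suc T"
proof -
  let ?S = "\<lambda>\<tau>. {j \<in> A. solved \<tau> j (run_output (hard_instance \<tau> j) s)}"
  let ?M = "Pow (- A) - unmasked s T"
  have "card {(\<tau>, j) \<in> Pow (- A) \<times> A. solved \<tau> j (run_output (hard_instance \<tau> j) s)}
      \<le> card (unmasked s T \<times> A \<union> Sigma ?M ?S)"
    by (intro card_mono) auto
  also have "\<dots> \<le> card (unmasked s T \<times> A) + card (Sigma ?M ?S)"
    by (rule card_Un_le)
  also have "card (unmasked s T \<times> A) \<le> (2 * N) ^ T * N"
    using card_unmasked[of s T] by (simp add: card_cartesian_product card_A)
  also have "card (Sigma ?M ?S) = (\<Sum>\<tau>\<in>?M. card (?S \<tau>))"
    by (rule card_SigmaI) auto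
  also have "\<dots> \<le> of_nat (card ?M) * Suc T"
    using calls by (intro sum_bounded_above card_solved_masked) auto
  also have "\<dots> \<le> 2 ^ N * Suc T"
  proof (rule mult_right_mono)
    have "card ?M \<le> card (Pow (- A))"
      by (intro card_mono) auto
    then show "of_nat (card ?M) \<le> (2 ^ N :: nat)"
      by (simp add: card_Pow card_compl)
  qed simp
  finally show ?thesis by simp
qed

section \<open>Averaging over the hard instances\<close>

definition error :: "'n set \<Rightarrow> 'n \<Rightarrow> real^'n \<Rightarrow> ennreal" where
  "error \<tau> j w = e2ennreal (composite_objective (hard_instance \<tau> j) w
     - composite_objective (hard_instance \<tau> j) (hidden \<tau> j))"

lemma expected_error_hard_instance:
  "expected_error R S (hard_instance \<tau> j) (hidden \<tau> j)
    = (\<integral>\<^sup>+ r. error \<tau> j (run_output (hard_instance \<tau> j) (S r)) \<partial>R)"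
  by (simp add: expected_error_def error_def)

lemma error_ge:
  assumes "\<not> solved \<tau> j w"
  shows "ennreal (\<alpha> / 4) \<le> error \<tau> j w"
proof -
  have "hidden \<tau> j \<in> feasible (hard_instance \<tau> j)"
    by (simp add: hard_instance_def hull_inc)
  then have hid: "composite_objective (hard_instance \<tau> j) (hidden \<tau> j) = ereal (obj (hidden \<tau> j))"
    by (simp add: composite_objective_def hard_instance_def)
  show ?thesis
  proof (cases "w \<in> feasible (hard_instance \<tau> j)")
    case True
    then have "composite_objective (hard_instance \<tau> j) w = ereal (obj w)"
      by (simp add: composite_objective_def hard_instance_def)
    moreover have "\<alpha> / 4 \<le> obj w - obj (hidden \<tau> j)"
      using assms True by (simp add: solved_def)
    ultimately show ?thesis
      by (simp add: error_def hid ennreal_leI)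
  next
    case False
    then show ?thesis
      by (simp add: error_def hid composite_objective_def)
  qed
qed

lemma borel_measurable_error: "error \<tau> j \<in> borel_measurable borel"
proof -
  have "continuous_on UNIV obj"
    unfolding obj_def diagonal_quadratic_def[abs_def] by (intro continuous_intros) auto
  then have [measurable]: "obj \<in> borel_measurable borel"
    by (rule borel_measurable_continuous_onI)
  have "compact (feasible (hard_instance \<tau> j))"
    using compact_decoys by (auto simp: hard_instance_def intro!: compact_convex_hull compact_insert)
  then have [measurable]: "feasible (hard_instance \<tau> j) \<in> sets borel"
    by (intro borel_closed compact_imp_closed)
  have [simp]: "objective (hard_instance \<tau> j) = obj"
    by (simp add: hard_instance_def)
  show ?thesis
    unfolding error_def[abs_def] composite_objective_def by simp measurable
qed

text \<open>For each fixed seed at least half of the pairs have error at least \<alpha>/4, so the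
  errors average to at least \<alpha>/8 over the pairs. Integrating over the seed and exchanging sum
  and integral, some pair has expected error at least \<alpha>/8.\<close>

lemma exists_hard_instance:
  assumes alg: "randomized_algorithm \<alpha> \<beta> R S" and budget: "projection_budget \<alpha> \<beta> R S T"
    and T1: "4 * (2 * N) ^ T \<le> 2 ^ N" and T2: "4 * Suc T \<le> N"
  shows "\<exists>\<tau>. \<exists>j\<in>A. ennreal (\<alpha> / 8) \<le> expected_error R S (hard_instance \<tau> j) (hidden \<tau> j)"
proof (rule ccontr)
  interpret R: prob_space R
    using alg by (simp add: randomized_algorithm_def)
  have of_nat_mult_ennreal: "of_nat n * ennreal (\<alpha> / numeral c) = ennreal (real n * (\<alpha> / numeral c))" for n c
    using \<alpha>_pos by (subst ennreal_mult) (auto simp: ennreal_of_nat_eq_real_of_nat)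
  let ?E = "\<lambda>(\<tau>, j). expected_error R S (hard_instance \<tau> j) (hidden \<tau> j)"
  let ?err = "\<lambda>(\<tau>, j) r. error \<tau> j (run_output (hard_instance \<tau> j) (S r))"
  let ?P = "Pow (- A) \<times> A"
  assume "\<not> (\<exists>\<tau>. \<exists>j\<in>A. ennreal (\<alpha> / 8) \<le> expected_error R S (hard_instance \<tau> j) (hidden \<tau> j))"
  then have small: "?E p < ennreal (\<alpha> / 8)" if "p \<in> ?P" for p
    using that by (auto simp: not_le)
  have P: "finite ?P" "?P \<noteq> {}" "card ?P = 2 ^ N * N"
    using A_nonempty by (auto simp: card_cartesian_product card_Pow card_compl card_A)
  have meas: "?err p \<in> borel_measurable R" if "p \<in> ?P" for p
  proof -
    from that obtain \<tau> j where p: "p = (\<tau>, j)" "j \<in> A" by auto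
    then have "(\<lambda>r. run_output (hard_instance \<tau> j) (S r)) \<in> borel_measurable R"
      using alg hard_instance_admissible by (auto simp: randomized_algorithm_def)
    then show ?thesis
      using measurable_compose[OF _ borel_measurable_error] by (simp add: p(1))
  qed
  have pointwise: "ennreal (real (card ?P) * (\<alpha> / 8)) \<le> (\<Sum>p\<in>?P. ?err p r)" if "r \<in> space R" for r
  proof -
    let ?S = "{(\<tau>, j) \<in> ?P. solved \<tau> j (run_output (hard_instance \<tau> j) (S r))}"
    have "card ?S \<le> (2 * N) ^ T * N + 2 ^ N * Suc T"
      using budget that hard_instance_admissible
      by (intro card_solved) (auto simp: projection_budget_def)
    \<comment> \<open>Each of the two terms in the bound of \<open>card_solved\<close> is at most a
      quarter of all pairs.\<close>
    moreover have "4 * (2 * N) ^ T * N \<le> 2 ^ N * N" "2 ^ N * (4 * Suc T) \<le> 2 ^ N * N"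
      using mult_right_mono[OF T1, of N] mult_left_mono[OF T2, of "2 ^ N"] by simp_all
    ultimately have half: "2 * card ?S \<le> card ?P"
      unfolding P(3) by linarith
    have diff: "card (?P - ?S) = card ?P - card ?S"
      by (rule card_Diff_subset) (auto intro: finite_subset[OF _ P(1)])
    have "real (card ?P) * (\<alpha> / 8) \<le> real (card (?P - ?S)) * (\<alpha> / 4)"
    proof -
      have "real (card ?P) \<le> 2 * real (card (?P - ?S))"
        using half unfolding diff by linarith
      then have "real (card ?P) * (\<alpha> / 8) \<le> 2 * real (card (?P - ?S)) * (\<alpha> / 8)"
        using \<alpha>_pos by (intro mult_right_mono) auto
      then show ?thesis by (simp add: mult_ac)
    qed
    then have "ennreal (real (card ?P) * (\<alpha> / 8)) \<le> ennreal (real (card (?P - ?S)) * (\<alpha> / 4))"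
      by (rule ennreal_leI)
    also have "\<dots> = (\<Sum>p\<in>?P - ?S. ennreal (\<alpha> / 4))"
      by (simp only: sum_constant of_nat_mult_ennreal)
    also have "\<dots> \<le> (\<Sum>p\<in>?P - ?S. ?err p r)"
      by (intro sum_mono) (auto intro: error_ge)
    also have "\<dots> \<le> (\<Sum>p\<in>?P. ?err p r)"
      using P(1) by (intro sum_mono2) auto
    finally show ?thesis .
  qed
  \<comment> \<open>There are finitely many pairs, so under the contrary assumption even the largest
    expected error is strictly below \<alpha>/8.\<close>
  define m where "m = Max (?E ` ?P)"
  have "m \<in> ?E ` ?P"
    unfolding m_def using P by (intro Max_in) auto
  then have m: "m < ennreal (\<alpha> / 8)"
    using small by auto
  have "ennreal (real (card ?P) * (\<alpha> / 8)) = (\<integral>\<^sup>+ r. ennreal (real (card ?P) * (\<alpha> / 8)) \<partial>R)"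
    by (simp add: R.emeasure_space_1)
  also have "\<dots> \<le> (\<integral>\<^sup>+ r. (\<Sum>p\<in>?P. ?err p r) \<partial>R)"
    by (rule nn_integral_mono) (rule pointwise)
  also have "\<dots> = (\<Sum>p\<in>?P. \<integral>\<^sup>+ r. ?err p r \<partial>R)"
    using meas by (rule nn_integral_sum)
  also have "\<dots> = (\<Sum>p\<in>?P. ?E p)"
    by (intro sum.cong) (auto simp: expected_error_hard_instance)
  also have "\<dots> \<le> of_nat (card ?P) * m"
    unfolding m_def using P by (intro sum_bounded_above Max_ge) auto
  also have "\<dots> < of_nat (card ?P) * ennreal (\<alpha> / 8)"
  proof (rule ennreal_mult_strict_left_mono[OF m])
    show "0 < (of_nat (card ?P) :: ennreal)"
      using P(1,2) by (simp only: of_nat_0_less_iff card_gt_0_iff) simp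
    show "of_nat (card ?P) < (top :: ennreal)"
      by (rule of_nat_less_top)
  qed
  also have "\<dots> = ennreal (real (card ?P) * (\<alpha> / 8))"
    by (rule of_nat_mult_ennreal)
  finally show False by simp
qed

end

section \<open>From the call budget to the lower bound\<close>

lemma budget_bounds:
  assumes N: "8 \<le> N" and T: "real T \<le> real N / (128 * ln (2 * real N))"
  shows "4 * (2 * N) ^ T \<le> 2 ^ N" and "4 * Suc T \<le> N"
proof -
  have "exp 1 \<le> 2 * real N"
    using exp_le N by simp
  then have ln_ge: "1 \<le> ln (2 * real N)"
    using N by (simp add: ln_ge_iff)
  then have T128: "real T * ln (2 * real N) \<le> real N / 128"
    using T by (simp add: field_simps)
  have "real T * 1 \<le> real T * ln (2 * real N)"
    using ln_ge by (rule mult_left_mono) simp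
  with T128 N have "real (4 * Suc T) \<le> real N"
    by simp
  then show "4 * Suc T \<le> N"
    by (simp only: of_nat_le_iff)
  have "real ((2 * N) ^ T) = exp (real T * ln (2 * real N))"
    using N by (simp add: exp_of_nat_mult)
  \<comment> \<open>The exponent on the left is at most N/128, far below (N - 2) * 2/3. Aiming at N
    - 2 rather than N yields the factor 4.\<close>
  also have "\<dots> \<le> exp (real (N - 2) * ln 2)"
  proof -
    have "real N / 128 \<le> real (N - 2) * (2 / 3)"
      using N by simp
    also have "\<dots> \<le> real (N - 2) * ln 2"
      using ln2_ge_two_thirds by (intro mult_left_mono) auto
    finally show ?thesis
      using T128 by simp
  qed
  also have "\<dots> = real (2 ^ (N - 2))"
    by (simp add: exp_of_nat_mult)
  finally have "(2 * N) ^ T \<le> 2 ^ (N - 2)"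
    by (simp only: of_nat_le_iff)
  then have "4 * (2 * N) ^ T \<le> 2 ^ 2 * 2 ^ (N - 2)"
    by simp
  also have "\<dots> = (2 :: nat) ^ N"
    unfolding power_add[symmetric] using N by (simp only: le_add_diff_inverse)
  finally show "4 * (2 * N) ^ T \<le> 2 ^ N" .
qed

lemma projection_budget_mono:
  "projection_budget \<alpha> \<beta> R S T \<Longrightarrow> T \<le> T' \<Longrightarrow> projection_budget \<alpha> \<beta> R S T'"
  unfolding projection_budget_def by (meson order.trans)

theorem theorem6:
  fixes \<alpha> \<beta> \<kappa> :: real and N :: nat
  assumes "\<alpha> > 0" and "\<beta> > 0"
    and "\<kappa> = \<beta> / \<alpha>" and "N = nat \<lfloor>(\<kappa> - 2) / 32\<rfloor>"
    and "\<kappa> \<ge> 258"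
    and "CARD('n::finite) = 2 * N"
  shows
    "(\<forall>(R :: 'r measure) (S :: 'r \<Rightarrow> (real^'n) strategy).
        randomized_algorithm \<alpha> \<beta> R S \<longrightarrow>
        projection_budget \<alpha> \<beta> R S (nat \<lfloor>real N / (128 * ln (2 * real N))\<rfloor>) \<longrightarrow>
        (\<exists>I wopt. admissible \<alpha> \<beta> I wopt \<and>
           expected_error R S I wopt \<ge> ennreal (\<alpha> / 8)))
     \<and>
     (\<forall>(R :: 'r measure) (S :: 'r \<Rightarrow> (real^'n) strategy).
        randomized_algorithm \<alpha> \<beta> R S \<longrightarrow>
        (\<forall>I wopt. admissible \<alpha> \<beta> I wopt \<longrightarrow>
           expected_error R S I wopt \<le> ennreal (\<alpha> / 16)) \<longrightarrow>
        (\<forall>T. projection_budget \<alpha> \<beta> R S T \<longrightarrow>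
           real T \<ge> 1 / 8192 * (\<kappa> / ln (2 * \<kappa>))))"
proof -
  \<comment> \<open>The threshold is 258 = 32 * 8 + 2.\<close>
  have "8 \<le> \<lfloor>(\<kappa> - 2) / 32\<rfloor>"
    using assms(5) by (simp add: le_floor_iff)
  then have int_N: "int N = \<lfloor>(\<kappa> - 2) / 32\<rfloor>" and N: "8 \<le> N"
    unfolding assms(4) by linarith+
  then have "real N = of_int \<lfloor>(\<kappa> - 2) / 32\<rfloor>"
    by (metis of_int_of_nat_eq)
  then have "real N \<le> (\<kappa> - 2) / 32" and N_gt: "(\<kappa> - 2) / 32 < real N + 1"
    using floor_correct[of "(\<kappa> - 2) / 32"] by simp_all
  then have N_le: "32 * real N + 2 \<le> \<kappa>"
    by simp
  define T0 where "T0 = nat \<lfloor>real N / (128 * ln (2 * real N))\<rfloor>"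
  have ln_pos: "0 < ln (2 * real N)"
    using N by simp
  then have T0: "real T0 \<le> real N / (128 * ln (2 * real N))"
    unfolding T0_def by simp
  obtain A :: "'n set" where A: "card A = N"
    using obtain_subset_with_card_n[of N "UNIV :: 'n set"] assms(6) by auto
  then have "card (- A) = N"
    using assms(6) by (simp add: Compl_eq_Diff_UNIV card_Diff_subset)
  moreover have "32 * real N * \<alpha> \<le> \<beta>"
  proof -
    have "32 * real N * \<alpha> \<le> \<kappa> * \<alpha>"
      using N_le assms(1) by (intro mult_right_mono) auto
    then show ?thesis
      using assms(1,3) by simp
  qed
  ultimately interpret hidden_vertex A N \<alpha> \<beta>
    using A N assms(1) by unfold_locales
  have hard: "\<exists>I wopt. admissible \<alpha> \<beta> I wopt \<and> ennreal (\<alpha> / 8) \<le> expected_error R S I wopt"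
    if "randomized_algorithm \<alpha> \<beta> R S" "projection_budget \<alpha> \<beta> R S T0"
    for R :: "'r measure" and S :: "'r \<Rightarrow> (real^'n) strategy"
    using exists_hard_instance[OF that budget_bounds[OF N T0]] hard_instance_admissible by blast
  have "1 / 8192 * (\<kappa> / ln (2 * \<kappa>)) \<le> real T"
    if alg: "randomized_algorithm \<alpha> \<beta> R S"
      and acc: "\<And>I wopt. admissible \<alpha> \<beta> I wopt \<Longrightarrow> expected_error R S I wopt \<le> ennreal (\<alpha> / 16)"
      and budget: "projection_budget \<alpha> \<beta> R S T"
    for R :: "'r measure" and S :: "'r \<Rightarrow> (real^'n) strategy" and T
  proof -
    have "\<not> T \<le> T0"
    proof
      assume "T \<le> T0"
      then obtain I wopt where "admissible \<alpha> \<beta> I wopt" "ennreal (\<alpha> / 8) \<le> expected_error R S I wopt"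
        using hard[OF alg projection_budget_mono[OF budget]] by blast
      with acc have "ennreal (\<alpha> / 8) \<le> ennreal (\<alpha> / 16)"
        using order.trans by blast
      with assms(1) show False
        by (simp add: ennreal_le_iff)
    qed
    \<comment> \<open>An integer exceeding the floor exceeds the number itself.\<close>
    then have T: "real N / (128 * ln (2 * real N)) < real T"
      unfolding T0_def by linarith
    \<comment> \<open>Here 8192 = 64 * 128. Rounding down loses at most a factor 2, since \<kappa> <
      32 N + 34 and this is at most 64 N; and \<open>N\<close> is at most \<kappa>, which orders the
      logarithms.\<close>
    have "1 / 8192 * (\<kappa> / ln (2 * \<kappa>)) = (\<kappa> / 64) / (128 * ln (2 * \<kappa>))"
      by simp
    also have "\<dots> \<le> real N / (128 * ln (2 * real N))"
      using N_gt N_le N ln_pos assms(5) by (intro frac_le) auto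
    finally show ?thesis
      using T by simp
  qed
  with hard show ?thesis
    unfolding T0_def by blast
qed

end
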